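(* Let $n\ge 2$ and let $h=\widetilde{\Theta}f(y_1,\dots,y_n)+c\in Z(\mathcal{V}_n)$ be an element of the center of $\mathcal{V}_n$, where $f\in\mathbb{C}[y_1,\dots,y_n]^{S_n}$ is a symmetric polynomial, $c\in\mathbb{C}$, and $\widetilde{\Theta}=\prod_{1\le i<j\le n}\bigl(1-(y_i-y_j)^2\bigr)$. Suppose $V$ is a finite-dimensional indecomposable calibrated representation of $\mathcal{V}_n$ on which some $e_i$, $1\le i\le n-1$, acts by a nonzero operator. Then $h\cdot v=cv$ for all $v\in V$.
   Context: For $n\ge 1$, the degenerate affine periplectic Brauer algebra $\mathcal{V}_n$ is the unital associative $\mathbb{C}$-algebra with generators $s_i,e_i$ ($1\le i\le n-1$) and $y_j$ ($1\le j\le n$) and relations (for all indices for which the expressions make sense): $s_i^2=1$; $s_is_j=s_js_i$, $s_ie_j=e_js_i$, $e_ie_j=e_je_i$ if $|i-j|>1$; $s_is_{i+1}s_i=s_{i+1}s_is_{i+1}$; $y_iy_j=y_jy_i$; $e_iy_j=y_je_i$ and $s_iy_j=y_js_i$ if $j\ne i,i+1$; $e_{i+1}e_ie_{i+1}=-e_{i+1}$; $e_ie_{i+1}e_i=-e_i$; $e_is_i=e_i$; $s_ie_i=-e_i$; $s_ie_{i+1}e_i=s_{i+1}e_i$; $s_{i+1}e_ie_{i+1}=-s_ie_{i+1}$; $e_{i+1}e_is_{i+1}=e_{i+1}s_i$; $e_ie_{i+1}s_i=-e_is_{i+1}$; $e_i^2=0$; $s_iy_i-y_{i+1}s_i=-e_i-1$;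 $y_is_i-s_iy_{i+1}=e_i-1$; $e_i(y_i-y_{i+1})=-e_i$; $(y_i-y_{i+1})e_i=e_i$. A representation $V$ of $\mathcal{V}_n$ is called calibrated if $V$ has a basis with respect to which $y_j$ acts by a diagonal matrix for all $j=1,\dots,n$ simultaneously. It is known that the center of $\mathcal{V}_n$ is $Z(\mathcal{V}_n)=\mathbb{C}\oplus\widetilde{\Theta}\,\mathbb{C}[y_1,\dots,y_n]^{S_n}$, so every central element has the form considered in the claim. All representations are finite-dimensional over $\mathbb{C}$. *)

theory Defs
  imports
    Complex_Main
    "HOL-Library.Poly_Mapping"
    "HOL-Combinatorics.Permutations"
    "HOL-Algebra.QuotRing"
begin

section \<open>Free associative algebras\<close>

text \<open>
  With the free monoid on \<open>'g\<close> as key type, the convolution product of \<^theory>\<open>HOL-Library.Poly_Mapping\<close>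
  makes \<open>'g free_monoid \<Rightarrow>\<^sub>0 complex\<close> the free associative algebra on \<open>'g\<close>.
  Its monoid operation is written additively because that is what this product expects.
\<close>

datatype 'g free_monoid = Word (letters_of: "'g list")

instantiation free_monoid :: (type) monoid_add
begin

definition zero_free_monoid :: "'g free_monoid" where
  "zero_free_monoid = Word []"

definition plus_free_monoid :: "'g free_monoid \<Rightarrow> 'g free_monoid \<Rightarrow> 'g free_monoid" where
  "plus_free_monoid u v = Word (letters_of u @ letters_of v)"

instance
  by standard (simp_all add: zero_free_monoid_def plus_free_monoid_def)

end

type_synonym 'g free_alg = "'g free_monoid \<Rightarrow>\<^sub>0 complex"

definition gen :: "'g \<Rightarrow> 'g free_alg" where
  "gen g = Poly_Mapping.single (Word [g]) 1"

definition const :: "complex \<Rightarrow> 'k::zero \<Rightarrow>\<^sub>0 complex" where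
  "const c = Poly_Mapping.single 0 c"

definition free_algebra :: "'g set \<Rightarrow> 'g free_alg ring" where
  "free_algebra X =
     \<lparr>carrier = {a. \<forall>w \<in> Poly_Mapping.keys a. set (letters_of w) \<subseteq> X},
      mult = (*), one = 1, zero = 0, add = (+)\<rparr>"

lemma ring_free_algebra: "ring (free_algebra X)"
proof (rule ringI)
  show "abelian_group (free_algebra X)"
  proof (rule abelian_groupI)
    fix x assume "x \<in> carrier (free_algebra X)"
    then have "- x \<in> carrier (free_algebra X)"
      by (auto simp: free_algebra_def in_keys_iff)
    then show "\<exists>y\<in>carrier (free_algebra X). y \<oplus>\<^bsub>free_algebra X\<^esub> x = \<zero>\<^bsub>free_algebra X\<^esub>"
      by (intro bexI[of _ "- x"]) (simp_all add: free_algebra_def)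
  qed (use keys_add in \<open>fastforce simp: free_algebra_def algebra_simps\<close>)+
  show "Group.monoid (free_algebra X)"
  proof (rule monoidI)
    fix x y assume *: "x \<in> carrier (free_algebra X)" "y \<in> carrier (free_algebra X)"
    have "set (letters_of w) \<subseteq> X" if w: "w \<in> Poly_Mapping.keys (x * y)" for w
    proof -
      obtain u v where "w = u + v" "u \<in> Poly_Mapping.keys x" "v \<in> Poly_Mapping.keys y"
        using w keys_mult[of x y] by blast
      with * show ?thesis
        by (auto simp: free_algebra_def plus_free_monoid_def)
    qed
    then show "x \<otimes>\<^bsub>free_algebra X\<^esub> y \<in> carrier (free_algebra X)"
      by (simp add: free_algebra_def)
  qed (simp_all add: free_algebra_def zero_free_monoid_def mult.assoc)
qed (simp_all add: free_algebra_def algebra_simps)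


section \<open>The degenerate affine periplectic Brauer algebra\<close>

datatype pb_gen = S nat | E nat | Y nat

definition pb_gens :: "nat \<Rightarrow> pb_gen set" where
  "pb_gens n = S ` {1..<n} \<union> E ` {1..<n} \<union> Y ` {1..n}"

abbreviation "sg i \<equiv> gen (S i)"
abbreviation "eg i \<equiv> gen (E i)"
abbreviation "yg j \<equiv> gen (Y j)"

inductive pb_rel :: "nat \<Rightarrow> pb_gen free_alg \<Rightarrow> pb_gen free_alg \<Rightarrow> bool" for n :: nat where
  "\<lbrakk>1 \<le> i; i < n\<rbrakk> \<Longrightarrow> pb_rel n (sg i * sg i) 1"
| "\<lbrakk>1 \<le> i; i < n; 1 \<le> j; j < n; i + 1 < j \<or> j + 1 < i\<rbrakk> \<Longrightarrow> pb_rel n (sg i * sg j) (sg j * sg i)"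
| "\<lbrakk>1 \<le> i; i < n; 1 \<le> j; j < n; i + 1 < j \<or> j + 1 < i\<rbrakk> \<Longrightarrow> pb_rel n (sg i * eg j) (eg j * sg i)"
| "\<lbrakk>1 \<le> i; i < n; 1 \<le> j; j < n; i + 1 < j \<or> j + 1 < i\<rbrakk> \<Longrightarrow> pb_rel n (eg i * eg j) (eg j * eg i)"
| "\<lbrakk>1 \<le> i; i + 1 < n\<rbrakk> \<Longrightarrow>
     pb_rel n (sg i * sg (i+1) * sg i) (sg (i+1) * sg i * sg (i+1))"
| "\<lbrakk>1 \<le> i; i \<le> n; 1 \<le> j; j \<le> n\<rbrakk> \<Longrightarrow> pb_rel n (yg i * yg j) (yg j * yg i)"
| "\<lbrakk>1 \<le> i; i < n; 1 \<le> j; j \<le> n; j \<noteq> i; j \<noteq> i + 1\<rbrakk> \<Longrightarrow> pb_rel n (eg i * yg j) (yg j * eg i)"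
| "\<lbrakk>1 \<le> i; i < n; 1 \<le> j; j \<le> n; j \<noteq> i; j \<noteq> i + 1\<rbrakk> \<Longrightarrow> pb_rel n (sg i * yg j) (yg j * sg i)"
| "\<lbrakk>1 \<le> i; i + 1 < n\<rbrakk> \<Longrightarrow> pb_rel n (eg (i+1) * eg i * eg (i+1)) (- eg (i+1))"
| "\<lbrakk>1 \<le> i; i + 1 < n\<rbrakk> \<Longrightarrow> pb_rel n (eg i * eg (i+1) * eg i) (- eg i)"
| "\<lbrakk>1 \<le> i; i < n\<rbrakk> \<Longrightarrow> pb_rel n (eg i * sg i) (eg i)"
| "\<lbrakk>1 \<le> i; i < n\<rbrakk> \<Longrightarrow> pb_rel n (sg i * eg i) (- eg i)"
| "\<lbrakk>1 \<le> i; i + 1 < n\<rbrakk> \<Longrightarrow> pb_rel n (sg i * eg (i+1) * eg i) (sg (i+1) * eg i)"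
| "\<lbrakk>1 \<le> i; i + 1 < n\<rbrakk> \<Longrightarrow> pb_rel n (sg (i+1) * eg i * eg (i+1)) (- (sg i * eg (i+1)))"
| "\<lbrakk>1 \<le> i; i + 1 < n\<rbrakk> \<Longrightarrow> pb_rel n (eg (i+1) * eg i * sg (i+1)) (eg (i+1) * sg i)"
| "\<lbrakk>1 \<le> i; i + 1 < n\<rbrakk> \<Longrightarrow> pb_rel n (eg i * eg (i+1) * sg i) (- (eg i * sg (i+1)))"
| "\<lbrakk>1 \<le> i; i < n\<rbrakk> \<Longrightarrow> pb_rel n (eg i * eg i) 0"
| "\<lbrakk>1 \<le> i; i < n\<rbrakk> \<Longrightarrow> pb_rel n (sg i * yg i - yg (i+1) * sg i) (- eg i - 1)"
| "\<lbrakk>1 \<le> i; i < n\<rbrakk> \<Longrightarrow> pb_rel n (yg i * sg i - sg i * yg (i+1)) (eg i - 1)"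
| "\<lbrakk>1 \<le> i; i < n\<rbrakk> \<Longrightarrow> pb_rel n (eg i * (yg i - yg (i+1))) (- eg i)"
| "\<lbrakk>1 \<le> i; i < n\<rbrakk> \<Longrightarrow> pb_rel n ((yg i - yg (i+1)) * eg i) (eg i)"

definition pb_ideal :: "nat \<Rightarrow> pb_gen free_alg set" where
  "pb_ideal n = Idl\<^bsub>free_algebra (pb_gens n)\<^esub> {a - b | a b. pb_rel n a b}"

lemma pb_rel_carrier:
  assumes "pb_rel n a b"
  shows "a - b \<in> carrier (free_algebra (pb_gens n))"
proof -
  let ?F = "free_algebra (pb_gens n)"
  interpret ring ?F by (rule ring_free_algebra)
  have mult: "x * y \<in> carrier ?F" if "x \<in> carrier ?F" "y \<in> carrier ?F" for x y
    using m_closed[OF that] by (simp add: free_algebra_def)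
  have one: "1 \<in> carrier ?F" and zero: "0 \<in> carrier ?F"
    using one_closed zero_closed by (simp_all add: free_algebra_def)
  have uminus: "- x \<in> carrier ?F" if "x \<in> carrier ?F" for x
    using that by (auto simp: free_algebra_def in_keys_iff)
  have minus: "x - y \<in> carrier ?F" if "x \<in> carrier ?F" "y \<in> carrier ?F" for x y
    using a_closed[OF that(1) uminus[OF that(2)]] by (simp add: free_algebra_def)
  have gen: "gen g \<in> carrier ?F" if "g \<in> pb_gens n" for g
    using that by (simp add: free_algebra_def gen_def)
  have S: "S i \<in> pb_gens n" and E: "E i \<in> pb_gens n" if "1 \<le> i" "i < n" for i
    using that by (auto simp: pb_gens_def)
  have Y: "Y i \<in> pb_gens n" if "1 \<le> i" "i \<le> n" for i
    using that by (auto simp: pb_gens_def)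
  show ?thesis
    using assms
    by cases (simp only:; intro mult one zero uminus minus gen S E Y; linarith)+
qed

definition pb_algebra :: "nat \<Rightarrow> pb_gen free_alg set ring" where
  "pb_algebra n = free_algebra (pb_gens n) Quot pb_ideal n"

lemma ideal_pb_ideal: "ideal (pb_ideal n) (free_algebra (pb_gens n))"
  unfolding pb_ideal_def
  by (rule ring.genideal_ideal[OF ring_free_algebra]) (auto intro: pb_rel_carrier)

lemma ring_pb_algebra: "ring (pb_algebra n)"
  unfolding pb_algebra_def by (rule ideal.quotient_is_ring[OF ideal_pb_ideal])

definition pb_class :: "nat \<Rightarrow> pb_gen free_alg \<Rightarrow> pb_gen free_alg set" where
  "pb_class n a = pb_ideal n +>\<^bsub>free_algebra (pb_gens n)\<^esub> a"

definition pb_scalar :: "nat \<Rightarrow> complex \<Rightarrow> pb_gen free_alg set" where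
  "pb_scalar n c = pb_class n (const c)"

definition ring_center :: "('a, 'm) ring_scheme \<Rightarrow> 'a set" where
  "ring_center R = {z \<in> carrier R. \<forall>x \<in> carrier R. z \<otimes>\<^bsub>R\<^esub> x = x \<otimes>\<^bsub>R\<^esub> z}"


section \<open>Polynomials in \<open>y\<^sub>1, \<dots>, y\<^sub>n\<close>\<close>

type_synonym cpoly = "(nat \<Rightarrow>\<^sub>0 nat) \<Rightarrow>\<^sub>0 complex"

definition pvar :: "nat \<Rightarrow> cpoly" where
  "pvar j = Poly_Mapping.single (Poly_Mapping.single j 1) 1"

definition polys :: "nat \<Rightarrow> cpoly set" where
  "polys n = {f. \<forall>m \<in> Poly_Mapping.keys f. Poly_Mapping.keys m \<subseteq> {1..n}}"

text \<open>
  Substitution of \<open>x 1, \<dots>, x n\<close> for the variables, \<open>\<kappa>\<close> being the embedding of the scalars.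
  The target need not be commutative; each monomial is evaluated in the order \<open>x\<^sub>1\<dots>x\<^sub>n\<close>,
  which is immaterial after passing to the quotient, where the \<open>y\<^sub>j\<close> commute.
\<close>

definition poly_eval :: "nat \<Rightarrow> (complex \<Rightarrow> 'a) \<Rightarrow> (nat \<Rightarrow> 'a) \<Rightarrow> cpoly \<Rightarrow> 'a::ring_1" where
  "poly_eval n \<kappa> x f =
     (\<Sum>m \<in> Poly_Mapping.keys f. \<kappa> (Poly_Mapping.lookup f m) *
        prod_list (map (\<lambda>j. x j ^ Poly_Mapping.lookup m j) [1..<Suc n]))"

definition symmetric_polys :: "nat \<Rightarrow> cpoly set" where
  "symmetric_polys n =
     {f \<in> polys n. \<forall>\<pi>. \<pi> permutes {1..n} \<longrightarrow> poly_eval n const (\<lambda>j. pvar (\<pi> j)) f = f}"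

definition theta_poly :: "nat \<Rightarrow> cpoly" where
  "theta_poly n = (\<Prod>j \<in> {1..n}. \<Prod>i \<in> {1..<j}. 1 - (pvar i - pvar j) ^ 2)"

definition pb_poly :: "nat \<Rightarrow> cpoly \<Rightarrow> pb_gen free_alg set" where
  "pb_poly n f = pb_class n (poly_eval n const (\<lambda>j. yg j) f)"


section \<open>Representations\<close>

text \<open>The representation space is the whole type \<open>'v\<close>, a vector space via \<open>scale\<close>.\<close>

definition End_ring :: "(complex \<Rightarrow> 'v \<Rightarrow> 'v::ab_group_add) \<Rightarrow> ('v \<Rightarrow> 'v) ring" where
  "End_ring scale =
     \<lparr>carrier = {f. Vector_Spaces.linear scale scale f},
      mult = (\<circ>), one = id, zero = (\<lambda>_. 0), add = (\<lambda>f g v. f v + g v)\<rparr>"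

text \<open>
  A homomorphism of unital \<open>\<complex>\<close>-algebras is a ring homomorphism compatible with the
  scalars \<open>c \<cdot> 1\<close>.
\<close>

definition pb_representation ::
    "nat \<Rightarrow> (complex \<Rightarrow> 'v \<Rightarrow> 'v::ab_group_add) \<Rightarrow> (pb_gen free_alg set \<Rightarrow> 'v \<Rightarrow> 'v) \<Rightarrow> bool" where
  "pb_representation n scale \<rho> \<longleftrightarrow>
     vector_space scale \<and>
     \<rho> \<in> ring_hom (pb_algebra n) (End_ring scale) \<and>
     (\<forall>c. \<rho> (pb_scalar n c) = scale c)"

definition finite_dimensional :: "(complex \<Rightarrow> 'v \<Rightarrow> 'v::ab_group_add) \<Rightarrow> bool" where
  "finite_dimensional scale \<longleftrightarrow> (\<exists>B. finite_dimensional_vector_space scale B)"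

definition pb_subrep ::
    "nat \<Rightarrow> (complex \<Rightarrow> 'v \<Rightarrow> 'v::ab_group_add) \<Rightarrow> (pb_gen free_alg set \<Rightarrow> 'v \<Rightarrow> 'v) \<Rightarrow> 'v set \<Rightarrow> bool" where
  "pb_subrep n scale \<rho> W \<longleftrightarrow>
     module.subspace scale W \<and> (\<forall>a \<in> carrier (pb_algebra n). \<rho> a ` W \<subseteq> W)"

definition pb_indecomposable ::
    "nat \<Rightarrow> (complex \<Rightarrow> 'v \<Rightarrow> 'v::ab_group_add) \<Rightarrow> (pb_gen free_alg set \<Rightarrow> 'v \<Rightarrow> 'v) \<Rightarrow> bool" where
  "pb_indecomposable n scale \<rho> \<longleftrightarrow>
     (UNIV :: 'v set) \<noteq> {0} \<and>
     (\<forall>U W. pb_subrep n scale \<rho> U \<and> pb_subrep n scale \<rho> W \<and>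
        {u + w | u w. u \<in> U \<and> w \<in> W} = UNIV \<and> U \<inter> W = {0} \<longrightarrow> U = {0} \<or> W = {0})"

text \<open>
  \<^locale>\<open>finite_dimensional_vector_space\<close> says that \<open>B\<close> is a (finite) basis; here it is a basis of
  simultaneous eigenvectors of the \<open>y\<^sub>j\<close>.
\<close>

definition pb_calibrated ::
    "nat \<Rightarrow> (complex \<Rightarrow> 'v \<Rightarrow> 'v::ab_group_add) \<Rightarrow> (pb_gen free_alg set \<Rightarrow> 'v \<Rightarrow> 'v) \<Rightarrow> bool" where
  "pb_calibrated n scale \<rho> \<longleftrightarrow>
     (\<exists>B. finite_dimensional_vector_space scale B \<and>
        (\<forall>j \<in> {1..n}. \<forall>b \<in> B. \<exists>\<mu>. \<rho> (pb_class n (yg j)) b = scale \<mu> b))"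

end

theory Submission
  imports Defs
begin

text \<open>
  Since \<open>V\<close> is calibrated, the central element \<open>h\<close> acts diagonally on a basis of joint eigenvectors
  of the \<open>y\<^sub>j\<close>; its \<open>c\<close>-eigenspace and the image of \<open>h - c\<close> are complementary subrepresentations,
  so by indecomposability it suffices to find one \<open>c\<close>-eigenvector.
  If \<open>e\<^sub>i v \<noteq> 0\<close>, then \<open>(y\<^sub>i - y\<^sub>i\<^sub>+\<^sub>1) e\<^sub>i v = e\<^sub>i v\<close>, so some joint eigenvector has
  eigenvalues with \<open>\<mu>\<^sub>i - \<mu>\<^sub>i\<^sub>+\<^sub>1 = 1\<close>. There the factor \<open>1 - (y\<^sub>i - y\<^sub>i\<^sub>+\<^sub>1)\<^sup>2\<close> of \<open>\<Theta>\<close> vanishes.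
\<close>

section \<open>Evaluation of polynomials at complex points\<close>

text \<open>With the identity as scalar embedding, the same \<open>poly_eval\<close> that builds
  elements of the free algebra yields their eigenvalues, so the two can be compared monomial by
  monomial.\<close>

abbreviation cpoly_eval :: "nat \<Rightarrow> (nat \<Rightarrow> complex) \<Rightarrow> cpoly \<Rightarrow> complex" where
  "cpoly_eval n \<equiv> poly_eval n (\<lambda>c. c)"

text \<open>Exponents of variables outside \<open>{1..n}\<close> are ignored, so evaluation is a
  ring homomorphism on all of \<open>cpoly\<close>, not only on \<open>polys n\<close>.\<close>

definition monom_eval :: "nat \<Rightarrow> (nat \<Rightarrow> complex) \<Rightarrow> (nat \<Rightarrow>\<^sub>0 nat) \<Rightarrow> complex" where
  "monom_eval n x m = (\<Prod>j\<leftarrow>[1..<Suc n]. x j ^ Poly_Mapping.lookup m j)"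

lemma monom_eval_zero: "monom_eval n x 0 = 1"
proof -
  have "(\<Prod>j\<leftarrow>js. x j ^ Poly_Mapping.lookup 0 j) = 1" for js :: "nat list"
    by (induction js) auto
  then show ?thesis
    unfolding monom_eval_def .
qed

lemma monom_eval_add: "monom_eval n x (m + m') = monom_eval n x m * monom_eval n x m'"
proof -
  have "(\<Prod>j\<leftarrow>js. x j ^ Poly_Mapping.lookup (m + m') j) =
      (\<Prod>j\<leftarrow>js. x j ^ Poly_Mapping.lookup m j) * (\<Prod>j\<leftarrow>js. x j ^ Poly_Mapping.lookup m' j)" for js
    by (induction js) (auto simp: lookup_add power_add)
  then show ?thesis
    unfolding monom_eval_def .
qed

lemma monom_eval_single:
  assumes "1 \<le> i" "i \<le> n"
  shows "monom_eval n x (Poly_Mapping.single i 1) = x i"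
proof -
  have "distinct js \<Longrightarrow>
      (\<Prod>j\<leftarrow>js. x j ^ Poly_Mapping.lookup (Poly_Mapping.single i 1) j) = (if i \<in> set js then x i else 1)"
    for js
    by (induction js) (auto simp: lookup_single when_def)
  from this[of "[1..<Suc n]"] show ?thesis
    using assms by (simp add: monom_eval_def)
qed

text \<open>Keys may cancel in a sum; a common index set lets \<open>f\<close>, \<open>g\<close> and
  \<open>f + g\<close> be compared termwise.\<close>

lemma cpoly_eval_superset:
  assumes "finite A" "Poly_Mapping.keys f \<subseteq> A"
  shows "cpoly_eval n x f = (\<Sum>m\<in>A. Poly_Mapping.lookup f m * monom_eval n x m)"
  unfolding poly_eval_def monom_eval_def
  by (rule sum.mono_neutral_left) (use assms in \<open>auto simp: in_keys_iff\<close>)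

lemma cpoly_eval_zero: "cpoly_eval n x 0 = 0"
  by (simp add: poly_eval_def)

lemma cpoly_eval_add: "cpoly_eval n x (f + g) = cpoly_eval n x f + cpoly_eval n x g"
proof -
  let ?A = "Poly_Mapping.keys f \<union> Poly_Mapping.keys g"
  have "Poly_Mapping.keys (f + g) \<subseteq> ?A"
    by (rule keys_add)
  then show ?thesis
    by (simp add: cpoly_eval_superset[of ?A] lookup_add algebra_simps sum.distrib)
qed

lemma cpoly_eval_uminus: "cpoly_eval n x (- f) = - cpoly_eval n x f"
  using cpoly_eval_add[of n x f "- f"] by (simp add: cpoly_eval_zero eq_neg_iff_add_eq_0 add.commute)

lemma cpoly_eval_diff: "cpoly_eval n x (f - g) = cpoly_eval n x f - cpoly_eval n x g"
  using cpoly_eval_add[of n x f "- g"] by (simp add: cpoly_eval_uminus)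

lemma cpoly_eval_sum: "cpoly_eval n x (\<Sum>k\<in>K. f k) = (\<Sum>k\<in>K. cpoly_eval n x (f k))"
  by (induction K rule: infinite_finite_induct) (simp_all add: cpoly_eval_zero cpoly_eval_add)

lemma cpoly_eval_single: "cpoly_eval n x (Poly_Mapping.single m c) = c * monom_eval n x m"
  by (subst cpoly_eval_superset[of "{m}"]) auto

lemma cpoly_eval_one: "cpoly_eval n x 1 = 1"
  using cpoly_eval_single[of n x 0 1] by (simp add: monom_eval_zero)

lemma cpoly_eval_pvar: "1 \<le> i \<Longrightarrow> i \<le> n \<Longrightarrow> cpoly_eval n x (pvar i) = x i"
  unfolding pvar_def by (simp only: cpoly_eval_single monom_eval_single mult_1_left)

lemma poly_mapping_sum_single:
  fixes f :: "'a \<Rightarrow>\<^sub>0 'b::comm_monoid_add"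
  shows "f = (\<Sum>m\<in>Poly_Mapping.keys f. Poly_Mapping.single m (Poly_Mapping.lookup f m))"
  by (rule poly_mapping_eqI)
    (auto simp: lookup_sum lookup_single when_def in_keys_iff)

lemma cpoly_eval_mult: "cpoly_eval n x (f * g) = cpoly_eval n x f * cpoly_eval n x g"
proof -
  let ?s = "\<lambda>h m. Poly_Mapping.single m (Poly_Mapping.lookup h m)"
  have "f * g = (\<Sum>m\<in>Poly_Mapping.keys f. ?s f m) * (\<Sum>m\<in>Poly_Mapping.keys g. ?s g m)"
    by (metis poly_mapping_sum_single)
  then have "f * g = (\<Sum>m\<in>Poly_Mapping.keys f. \<Sum>m'\<in>Poly_Mapping.keys g.
      Poly_Mapping.single (m + m') (Poly_Mapping.lookup f m * Poly_Mapping.lookup g m'))"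
    by (simp add: sum_product mult_single)
  then have "cpoly_eval n x (f * g) = (\<Sum>m\<in>Poly_Mapping.keys f. \<Sum>m'\<in>Poly_Mapping.keys g.
      Poly_Mapping.lookup f m * Poly_Mapping.lookup g m' * (monom_eval n x m * monom_eval n x m'))"
    by (simp add: cpoly_eval_sum cpoly_eval_single monom_eval_add)
  also have "\<dots> = cpoly_eval n x f * cpoly_eval n x g"
    by (simp add: sum_product cpoly_eval_superset[OF finite_keys order_refl] mult_ac)
  finally show ?thesis .
qed

lemma cpoly_eval_prod: "cpoly_eval n x (\<Prod>k\<in>K. f k) = (\<Prod>k\<in>K. cpoly_eval n x (f k))"
  by (induction K rule: infinite_finite_induct) (simp_all add: cpoly_eval_one cpoly_eval_mult)

lemma cpoly_eval_theta:
  "cpoly_eval n x (theta_poly n) = (\<Prod>j\<in>{1..n}. \<Prod>i\<in>{1..<j}. 1 - (x i - x j)\<^sup>2)"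
  unfolding theta_poly_def cpoly_eval_prod
  by (intro prod.cong refl)
    (auto simp: power2_eq_square cpoly_eval_diff cpoly_eval_mult cpoly_eval_one cpoly_eval_pvar)

lemma cpoly_eval_theta_eq_0:
  assumes "1 \<le> i" "i < n" "x i - x (i + 1) = 1"
  shows "cpoly_eval n x (theta_poly n) = 0"
  unfolding cpoly_eval_theta
  \<comment> \<open>The outer index \<open>i + 1\<close> and the inner index \<open>i\<close> select
    the factor \<open>1 - 1^2\<close>.\<close>
  by (rule prod_zero, simp, rule bexI[of _ "i + 1"], rule prod_zero, simp, rule bexI[of _ i])
    (use assms in auto)


section \<open>Diagonalizable operators\<close>

text \<open>Both sides are linear in \<open>v\<close> and agree on \<open>B\<close>. In this form an
  eigenvalue can be read off from any vector with a nonzero \<open>b\<close>-coordinate.\<close>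

lemma (in vector_space) representation_diagonal:
  assumes B: "independent B" "span B = UNIV"
    and f: "Vector_Spaces.linear scale scale f"
    and eig: "\<And>b. b \<in> B \<Longrightarrow> f b = scale (l b) b"
    and b: "b \<in> B"
  shows "representation B (f v) b = l b * representation B v b"
proof -
  interpret f: Vector_Spaces.linear scale scale f by (rule f)
  have "v \<in> span B" by (simp add: B)
  then show ?thesis
  proof (induction v rule: span_induct_alt)
    case base
    show ?case by (simp add: f.zero representation_zero)
  next
    case (step a y z)
    then show ?case
      by (auto simp: B f.add f.scale eig representation_add representation_scale
          representation_basis algebra_simps)
  qed
qed

lemma (in vector_space) representation_eq_0_imp_eq_0:
  assumes "independent B" "span B = UNIV" "\<And>b. b \<in> B \<Longrightarrow> representation B v b = 0"
  shows "v = 0"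
proof -
  have "representation B v b = 0" for b
    using assms(3) representation_ne_zero[of B v b] by blast
  then show ?thesis
    using sum_nonzero_representation_eq[of B v] assms(1,2) by simp
qed

text \<open>Basis vectors with eigenvalue 0 lie in the kernel, the others in the range. The
  intersection is trivial because a diagonal operator has no nilpotent part.\<close>

lemma (in vector_space) diagonal_kernel_image_complementary:
  assumes B: "independent B" "span B = UNIV"
    and f: "Vector_Spaces.linear scale scale f"
    and eig: "\<And>b. b \<in> B \<Longrightarrow> f b = scale (l b) b"
  shows "{u + w | u w. f u = 0 \<and> w \<in> range f} = UNIV"
    and "{v. f v = 0} \<inter> range f = {0}"
proof -
  interpret f: Vector_Spaces.linear scale scale f by (rule f)
  let ?P = "{u + w | u w. f u = 0 \<and> w \<in> range f}"
  have "subspace ?P"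
    using subspace_sums[OF f.subspace_kernel f.subspace_image[OF subspace_UNIV]] by simp
  moreover have "b \<in> ?P" if b: "b \<in> B" for b
  proof (cases "l b = 0")
    case True
    then have "f b = 0" using eig[OF b] by simp
    moreover have "b = b + f 0" by (simp add: f.zero)
    ultimately show ?thesis by blast
  next
    case False
    then have "b = 0 + f (scale (inverse (l b)) b)"
      using eig[OF b] by (simp add: f.scale)
    then show ?thesis using f.zero by blast
  qed
  ultimately have "span B \<subseteq> ?P"
    by (intro span_minimal) (rule subsetI)
  then show "?P = UNIV"
    unfolding B(2) by (rule top.extremum_uniqueI)
  have "f v = 0" if "f (f v) = 0" for v
  proof (rule representation_eq_0_imp_eq_0[OF B])
    fix b assume b: "b \<in> B"
    note r = representation_diagonal[OF B f eig b]
    \<comment> \<open>The \<open>b\<close>-coordinate of \<open>f (f v) = 0\<close>; over a field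
      the square of \<open>l b\<close> can be replaced by \<open>l b\<close> itself.\<close>
    have "l b * (l b * representation B v b) = 0"
      using r[of "f v"] r[of v] that by (simp add: representation_zero)
    then show "representation B (f v) b = 0"
      using r[of v] by simp
  qed
  then show "{v. f v = 0} \<inter> range f = {0}"
    using rangeI[of f 0] by (auto simp: f.zero)
qed


section \<open>Representations of the algebra\<close>

abbreviation pb_free :: "nat \<Rightarrow> pb_gen free_alg ring" where
  "pb_free n \<equiv> free_algebra (pb_gens n)"

locale pb_rep =
  fixes n :: nat
    and scale :: "complex \<Rightarrow> 'v \<Rightarrow> 'v::ab_group_add"
    and \<rho> :: "pb_gen free_alg set \<Rightarrow> 'v \<Rightarrow> 'v"
  assumes rep: "pb_representation n scale \<rho>"
begin

sublocale vector_space scale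
  using rep by (simp add: pb_representation_def)

text \<open>The action is pulled back to the free algebra, where sums and products are the type
  class operations instead of coset operations.\<close>

definition act :: "pb_gen free_alg \<Rightarrow> 'v \<Rightarrow> 'v" where
  "act a = \<rho> (pb_class n a)"

lemma rho_hom: "\<rho> \<in> ring_hom (pb_algebra n) (End_ring scale)"
  using rep by (simp add: pb_representation_def)

lemma pb_class_hom: "pb_class n \<in> ring_hom (pb_free n) (pb_algebra n)"
  using ideal.rcos_ring_hom[OF ideal_pb_ideal]
  unfolding pb_class_def[abs_def] pb_algebra_def .

lemma act_hom: "act \<in> ring_hom (pb_free n) (End_ring scale)"
  using ring_hom_trans[OF pb_class_hom rho_hom] by (simp add: act_def[abs_def] comp_def)

lemma act_linear: "a \<in> carrier (pb_free n) \<Longrightarrow> Vector_Spaces.linear scale scale (act a)"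
  using ring_hom_closed[OF act_hom] by (simp add: End_ring_def)

lemma rho_linear: "a \<in> carrier (pb_algebra n) \<Longrightarrow> Vector_Spaces.linear scale scale (\<rho> a)"
  using ring_hom_closed[OF rho_hom] by (simp add: End_ring_def)

lemma act_scale: "a \<in> carrier (pb_free n) \<Longrightarrow> act a (scale c v) = scale c (act a v)"
  using module_hom.scale[OF module_hom_iff_linear[THEN iffD2, OF act_linear]] .

lemma rho_zero: "a \<in> carrier (pb_algebra n) \<Longrightarrow> \<rho> a 0 = 0"
  using module_hom.zero[OF module_hom_iff_linear[THEN iffD2, OF rho_linear]] .

lemma act_mult:
  "a \<in> carrier (pb_free n) \<Longrightarrow> b \<in> carrier (pb_free n) \<Longrightarrow> act (a * b) v = act a (act b v)"
  using ring_hom_mult[OF act_hom, of a b] by (simp add: End_ring_def free_algebra_def)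

lemma act_add:
  "a \<in> carrier (pb_free n) \<Longrightarrow> b \<in> carrier (pb_free n) \<Longrightarrow> act (a + b) v = act a v + act b v"
  using ring_hom_add[OF act_hom, of a b] by (simp add: End_ring_def free_algebra_def)

lemma act_one: "act 1 v = v"
  using ring_hom_one[OF act_hom] by (simp add: End_ring_def free_algebra_def)

lemma act_const: "act (const c) v = scale c v"
  using rep by (simp add: act_def pb_representation_def pb_scalar_def)

section \<open>Closure properties of the free algebra on the generators\<close>

lemma
  shows one_in_free: "1 \<in> carrier (pb_free n)"
    and zero_in_free: "0 \<in> carrier (pb_free n)"
    and const_in_free: "const c \<in> carrier (pb_free n)"
    and gen_in_free: "g \<in> pb_gens n \<Longrightarrow> gen g \<in> carrier (pb_free n)"
  by (auto simp: free_algebra_def const_def gen_def zero_free_monoid_def)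

lemma mult_in_free:
  "a \<in> carrier (pb_free n) \<Longrightarrow> b \<in> carrier (pb_free n) \<Longrightarrow> a * b \<in> carrier (pb_free n)"
  using ring.ring_simprules(5)[OF ring_free_algebra, of a "pb_gens n" b] by (simp add: free_algebra_def)

lemma add_in_free:
  "a \<in> carrier (pb_free n) \<Longrightarrow> b \<in> carrier (pb_free n) \<Longrightarrow> a + b \<in> carrier (pb_free n)"
  using ring.ring_simprules(1)[OF ring_free_algebra, of a "pb_gens n" b] by (simp add: free_algebra_def)

lemma uminus_in_free: "a \<in> carrier (pb_free n) \<Longrightarrow> - a \<in> carrier (pb_free n)"
  by (auto simp: free_algebra_def in_keys_iff)

lemma diff_in_free:
  "a \<in> carrier (pb_free n) \<Longrightarrow> b \<in> carrier (pb_free n) \<Longrightarrow> a - b \<in> carrier (pb_free n)"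
  using add_in_free[OF _ uminus_in_free] by simp

lemma yg_in_free: "1 \<le> j \<Longrightarrow> j \<le> n \<Longrightarrow> yg j \<in> carrier (pb_free n)"
  by (rule gen_in_free) (auto simp: pb_gens_def)

lemma eg_in_free: "1 \<le> i \<Longrightarrow> i < n \<Longrightarrow> eg i \<in> carrier (pb_free n)"
  by (rule gen_in_free) (auto simp: pb_gens_def)

section \<open>Defining relations as identities between operators\<close>

lemma act_diff:
  assumes "a \<in> carrier (pb_free n)" "b \<in> carrier (pb_free n)"
  shows "act (a - b) v = act a v - act b v"
  using act_add[OF diff_in_free[OF assms] assms(2), of v] by simp

text \<open>The difference \<open>a - b\<close> lies in the ideal, hence acts as 0. Membership of
  \<open>a\<close> and \<open>b\<close> is assumed separately because \<open>pb_rel_carrier\<close>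
  covers only their difference.\<close>

lemma act_pb_rel:
  assumes "pb_rel n a b" "a \<in> carrier (pb_free n)" "b \<in> carrier (pb_free n)"
  shows "act a v = act b v"
proof -
  interpret ideal "pb_ideal n" "pb_free n" by (rule ideal_pb_ideal)
  have "a - b \<in> pb_ideal n"
    unfolding pb_ideal_def using assms(1)
    by (intro subsetD[OF ring.genideal_self[OF ring_free_algebra]])
      (auto intro: pb_rel_carrier)
  \<comment> \<open>Both cosets are the ideal itself.\<close>
  then have "pb_class n (a - b) = pb_class n 0"
    unfolding pb_class_def
    using a_rcos_const[of "a - b"] a_rcos_const[OF additive_subgroup.zero_closed[OF is_additive_subgroup]] by (simp add: free_algebra_def)
  then have "act (a - b) v = act 0 v"
    by (simp add: act_def)
  \<comment> \<open>Here 0 is written as \<open>a - a\<close>.\<close>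
  also have "act 0 v = 0"
    using act_diff[OF assms(2,2)] by simp
  finally show ?thesis
    using act_diff[OF assms(2,3)] by simp
qed

text \<open>This is the last defining relation; it makes every nonzero \<open>act (eg i) v\<close>
  an eigenvector of \<open>yg i - yg (i + 1)\<close> with eigenvalue 1.\<close>

lemma act_y_diff_e:
  assumes "1 \<le> i" "i < n"
  shows "act (yg i - yg (i + 1)) (act (eg i) v) = act (eg i) v"
proof -
  have c: "yg i - yg (i + 1) \<in> carrier (pb_free n)" "eg i \<in> carrier (pb_free n)"
    using assms by (auto intro!: diff_in_free yg_in_free eg_in_free)
  have "pb_rel n ((yg i - yg (i + 1)) * eg i) (eg i)"
    using assms by (rule pb_rel.intros)
  then show ?thesis
    using act_pb_rel[OF _ mult_in_free[OF c] c(2)] act_mult[OF c] by simp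
qed

section \<open>Polynomials in the \<open>yg j\<close> on joint eigenvectors\<close>

lemma act_power_eigenvector:
  assumes "a \<in> carrier (pb_free n)" "act a v = scale \<mu> v"
  shows "a ^ k \<in> carrier (pb_free n) \<and> act (a ^ k) v = scale (\<mu> ^ k) v"
proof (induction k)
  case 0
  show ?case by (simp add: one_in_free act_one)
next
  case (Suc k)
  then show ?case
    using assms
    by (simp add: act_scale mult_in_free act_mult scale_scale mult.commute)
qed

text \<open>Membership is proved together with the eigenvalue, since \<open>act_mult\<close> needs
  it for the partial products in the induction.\<close>

lemma act_prod_list_eigenvector:
  assumes "\<And>j. j \<in> set js \<Longrightarrow> a j \<in> carrier (pb_free n) \<and> act (a j) v = scale (\<mu> j) v"
  shows "prod_list (map a js) \<in> carrier (pb_free n) \<and>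
    act (prod_list (map a js)) v = scale (prod_list (map \<mu> js)) v"
  using assms
proof (induction js)
  case Nil
  show ?case by (simp add: one_in_free act_one)
next
  case (Cons j js)
  then show ?case
    by (simp add: act_scale mult_in_free act_mult scale_scale mult.commute)
qed

lemma act_sum_eigenvector:
  assumes "\<And>k. k \<in> K \<Longrightarrow> a k \<in> carrier (pb_free n) \<and> act (a k) v = scale (\<mu> k) v"
  shows "sum a K \<in> carrier (pb_free n) \<and> act (sum a K) v = scale (sum \<mu> K) v"
  using assms
proof (induction K rule: infinite_finite_induct)
  case (insert k K)
  then show ?case
    by (simp add: add_in_free act_add scale_left_distrib)
\<comment> \<open>For an empty or infinite index set both sums are 0, and \<open>act 0 v = 0\<close>
  follows from \<open>0 = 0 - 0\<close>.\<close>
qed (use act_diff[OF zero_in_free zero_in_free] in \<open>simp_all add: zero_in_free\<close>)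

text \<open>On a joint eigenvector each factor contributes only a scalar, so the noncommutative
  evaluation collapses to a complex one.\<close>

lemma act_poly_eval_eigenvector:
  assumes "\<And>j. 1 \<le> j \<Longrightarrow> j \<le> n \<Longrightarrow> act (yg j) v = scale (\<mu> j) v"
  shows "poly_eval n const yg g \<in> carrier (pb_free n) \<and>
    act (poly_eval n const yg g) v = scale (cpoly_eval n \<mu> g) v"
  unfolding poly_eval_def
proof (rule act_sum_eigenvector)
  fix m
  let ?p = "prod_list (map (\<lambda>j. yg j ^ Poly_Mapping.lookup m j) [1..<Suc n])"
  let ?q = "prod_list (map (\<lambda>j. \<mu> j ^ Poly_Mapping.lookup m j) [1..<Suc n])"
  have "?p \<in> carrier (pb_free n) \<and> act ?p v = scale ?q v"
    by (rule act_prod_list_eigenvector)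
      (rule act_power_eigenvector[OF yg_in_free assms]; auto)
  then show "const (Poly_Mapping.lookup g m) * ?p \<in> carrier (pb_free n) \<and>
      act (const (Poly_Mapping.lookup g m) * ?p) v = scale (Poly_Mapping.lookup g m * ?q) v"
    by (simp add: mult_in_free const_in_free act_mult act_const del: upt_Suc)
qed

lemma poly_eval_in_free: "poly_eval n const yg g \<in> carrier (pb_free n)"
proof -
  \<comment> \<open>The zero vector counts as a joint eigenvector, so the membership half of the
    preceding lemma becomes available unconditionally.\<close>
  have "act (yg j) 0 = scale 0 0" if "1 \<le> j" "j \<le> n" for j
    using act_scale[OF yg_in_free[OF that], of 0 0] by simp
  then show ?thesis
    using act_poly_eval_eigenvector[of 0 "\<lambda>_. 0"] by blast
qed

section \<open>Central elements and weights\<close>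

lemma rho_theta_mult_add_scalar:
  "\<rho> (pb_poly n g \<otimes>\<^bsub>pb_algebra n\<^esub> pb_poly n f \<oplus>\<^bsub>pb_algebra n\<^esub> pb_scalar n c) v =
    act (poly_eval n const yg g) (act (poly_eval n const yg f) v) + scale c v"
proof -
  let ?g = "poly_eval n const yg g" and ?f = "poly_eval n const yg f"
  have c: "?g \<in> carrier (pb_free n)" "?f \<in> carrier (pb_free n)" "?g * ?f \<in> carrier (pb_free n)"
    by (simp_all add: poly_eval_in_free mult_in_free)
  have "pb_poly n g \<otimes>\<^bsub>pb_algebra n\<^esub> pb_poly n f = pb_class n (?g * ?f)"
    using ring_hom_mult[OF pb_class_hom c(1,2)] by (simp add: pb_poly_def free_algebra_def)
  then have "pb_poly n g \<otimes>\<^bsub>pb_algebra n\<^esub> pb_poly n f \<oplus>\<^bsub>pb_algebra n\<^esub> pb_scalar n c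
      = pb_class n (?g * ?f + const c)"
    using ring_hom_add[OF pb_class_hom c(3) const_in_free]
    by (simp add: pb_scalar_def free_algebra_def)
  then show ?thesis
    using act_add[OF c(3) const_in_free] act_mult[OF c(1,2)] act_const
    by (simp add: act_def)
qed

text \<open>Plays the part of Schur's lemma for an indecomposable module. Indecomposability by
  itself would still permit a nilpotent \<open>h - c\<close>; the eigenbasis excludes it.\<close>

lemma central_diagonal_is_scalar:
  assumes indec: "pb_indecomposable n scale \<rho>"
    and central: "h \<in> ring_center (pb_algebra n)"
    and B: "independent B" "span B = UNIV"
    and eig: "\<And>b. b \<in> B \<Longrightarrow> \<rho> h b = scale (l b) b"
    and b: "b \<in> B" "l b = c"
  shows "\<rho> h v = scale c v"
proof -
  define N where "N v = \<rho> h v - scale c v" for v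
  have h: "h \<in> carrier (pb_algebra n)"
    using central by (simp add: ring_center_def)
  have N: "Vector_Spaces.linear scale scale N"
    unfolding N_def[abs_def]
    using vector_space_pair.linear_compose_sub[OF _ rho_linear[OF h] linear_scale_self]
    by (simp add: vector_space_pair_def vector_space_axioms)
  interpret N: Vector_Spaces.linear scale scale N by (rule N)
  \<comment> \<open>Centrality of \<open>h\<close> makes the kernel and the range of
    \<open>N\<close> invariant under the algebra.\<close>
  have commute: "N (\<rho> a v) = \<rho> a (N v)" if a: "a \<in> carrier (pb_algebra n)" for a v
  proof -
    interpret a: Vector_Spaces.linear scale scale "\<rho> a" by (rule rho_linear[OF a])
    have "\<rho> h \<circ> \<rho> a = \<rho> a \<circ> \<rho> h"
      using ring_hom_mult[OF rho_hom h a] ring_hom_mult[OF rho_hom a h] central a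
      by (simp add: ring_center_def End_ring_def)
    then show ?thesis
      by (simp add: N_def a.diff a.scale fun_eq_iff)
  qed
  have N_eig: "N b = scale (l b - c) b" if "b \<in> B" for b
    using eig[OF that] by (simp add: N_def scale_left_diff_distrib)
  note compl = diagonal_kernel_image_complementary[OF B N N_eig]
  have "pb_subrep n scale \<rho> {v. N v = 0}"
    unfolding pb_subrep_def
    using N.subspace_kernel commute rho_zero by auto
  moreover have "pb_subrep n scale \<rho> (range N)"
    unfolding pb_subrep_def
    using N.subspace_image[OF subspace_UNIV] by (auto simp: commute[symmetric])
  moreover have "{u + w | u w. u \<in> {v. N v = 0} \<and> w \<in> range N} = UNIV"
    using compl(1) by simp
  ultimately have "{v. N v = 0} = {0} \<or> range N = {0}"
    using indec compl(2) unfolding pb_indecomposable_def by blast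
  \<comment> \<open>This nonzero kernel vector rules out the first alternative, so the range of
    \<open>N\<close> is zero.\<close>
  moreover have "N b = 0" "b \<noteq> 0"
    using N_eig[OF b(1)] b dependent_zero[of B] B(1) by auto
  ultimately have "N v = 0"
    by auto
  then show ?thesis
    by (simp add: N_def)
qed

text \<open>The vector \<open>act (eg i) v\<close> is fixed by \<open>yg i - yg (i + 1)\<close>,
  which multiplies its \<open>b\<close>-coordinate by the difference of the two eigenvalues. Any
  \<open>b\<close> with a nonzero coordinate therefore has difference 1.\<close>

lemma calibrated_e_nonzero_weight:
  assumes B: "independent B" "span B = UNIV"
    and eig: "\<And>j b. 1 \<le> j \<Longrightarrow> j \<le> n \<Longrightarrow> b \<in> B \<Longrightarrow> act (yg j) b = scale (\<mu> b j) b"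
    and i: "1 \<le> i" "i < n" and v: "act (eg i) v \<noteq> 0"
  obtains b where "b \<in> B" "\<mu> b i - \<mu> b (i + 1) = 1"
proof -
  let ?w = "act (eg i) v" and ?d = "yg i - yg (i + 1)"
  have y: "yg i \<in> carrier (pb_free n)" "yg (i + 1) \<in> carrier (pb_free n)"
    using i by (auto intro: yg_in_free)
  have d: "Vector_Spaces.linear scale scale (act ?d)"
    by (rule act_linear[OF diff_in_free[OF y]])
  have d_eig: "act ?d b = scale (\<mu> b i - \<mu> b (i + 1)) b" if "b \<in> B" for b
    using eig[of i b] eig[of "i + 1" b] i that
    by (simp add: act_diff[OF y, simplified] scale_left_diff_distrib)
  obtain b where b: "b \<in> B" "representation B ?w b \<noteq> 0"
    using representation_eq_0_imp_eq_0[OF B, of ?w] v by blast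
  have "representation B ?w b = (\<mu> b i - \<mu> b (i + 1)) * representation B ?w b"
    using representation_diagonal[OF B d d_eig b(1), of ?w] act_y_diff_e[OF i]
    by simp
  then show ?thesis
    using that b by simp
qed

end

theorem corollary26:
  fixes n :: nat
    and f :: cpoly
    and c :: complex
    and h :: "pb_gen free_alg set"
    and scale :: "complex \<Rightarrow> 'v \<Rightarrow> 'v::ab_group_add"
    and \<rho> :: "pb_gen free_alg set \<Rightarrow> 'v \<Rightarrow> 'v"
  assumes "n \<ge> 2"
    and "f \<in> symmetric_polys n"
    and "h = (pb_poly n (theta_poly n) \<otimes>\<^bsub>pb_algebra n\<^esub> pb_poly n f) \<oplus>\<^bsub>pb_algebra n\<^esub> pb_scalar n c"
    and "h \<in> ring_center (pb_algebra n)"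
    and "pb_representation n scale \<rho>"
    and "finite_dimensional scale"
    and "pb_indecomposable n scale \<rho>"
    and "pb_calibrated n scale \<rho>"
    and "\<exists>i \<in> {1..n - 1}. \<rho> (pb_class n (eg i)) \<noteq> (\<lambda>v. 0)"
  shows "\<forall>v. \<rho> h v = scale c v"
proof -
  interpret pb_rep n scale \<rho>
    by standard (fact assms(5))
  obtain B where fdB: "finite_dimensional_vector_space scale B"
    and ex: "\<forall>j\<in>{1..n}. \<forall>b\<in>B. \<exists>\<mu>. act (yg j) b = scale \<mu> b"
    using assms(8) unfolding pb_calibrated_def act_def by blast
  \<comment> \<open>The choice is meaningful only for \<open>b\<close> in \<open>B\<close> and
    \<open>j\<close> in \<open>{1..n}\<close>, and \<open>cpoly_eval n\<close> reads only those
    indices \<open>j\<close>.\<close>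
  define \<mu> where "\<mu> b j = (SOME m. act (yg j) b = scale m b)" for b j
  have B: "independent B" "span B = UNIV"
    using fdB unfolding finite_dimensional_vector_space_def finite_dimensional_vector_space_axioms_def
    by blast+
  have eig: "act (yg j) b = scale (\<mu> b j) b" if "1 \<le> j" "j \<le> n" "b \<in> B" for j b
    unfolding \<mu>_def by (rule someI_ex) (use ex that in auto)
  let ?l = "\<lambda>b. cpoly_eval n (\<mu> b) (theta_poly n) * cpoly_eval n (\<mu> b) f + c"
  have h_eig: "\<rho> h b = scale (?l b) b" if b: "b \<in> B" for b
  proof -
    let ?t = "poly_eval n const yg (theta_poly n)"
    note p = act_poly_eval_eigenvector[OF eig[OF _ _ b]]
    have "\<rho> h b = act ?t (act (poly_eval n const yg f) b) + scale c b"
      unfolding assms(3) by (rule rho_theta_mult_add_scalar)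
    \<comment> \<open>The scalar produced by \<open>f\<close> moves out through the linear operator
      of the theta polynomial.\<close>
    also have "\<dots> = scale (cpoly_eval n (\<mu> b) f) (act ?t b) + scale c b"
      using p[of f] act_scale[OF poly_eval_in_free] by simp
    also have "\<dots> = scale (?l b) b"
      using p[of "theta_poly n"] by (simp add: scale_left_distrib mult.commute)
    finally show ?thesis .
  qed
  obtain i v where i: "1 \<le> i" "i < n" and v: "act (eg i) v \<noteq> 0"
    using assms(1,9) by (fastforce simp: act_def fun_eq_iff)
  obtain b where b: "b \<in> B" "\<mu> b i - \<mu> b (i + 1) = 1"
    using calibrated_e_nonzero_weight[OF B eig i v] by blast
  \<comment> \<open>The theta polynomial vanishes at the weight of \<open>b\<close>, which kills the
    term with \<open>f\<close>.\<close>
  have "?l b = c"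
    using cpoly_eval_theta_eq_0[where x = "\<mu> b", OF i b(2)] by simp
  then show ?thesis
    using central_diagonal_is_scalar[OF assms(7,4) B h_eig b(1)] by blast
qed

end
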